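(* Let $n$ be a positive integer divisible by $3$. In the $(1 : 1)$ Maker-Breaker game $\mathcal{TF}_n$, Breaker has a strategy ensuring that Maker does not win in fewer than $7n/6$ moves.
   Context: $\mathcal{TF}_n$ is the Maker-Breaker game whose board is the edge set $E(K_n)$ of the complete graph on $n$ vertices and whose winning sets are the edge sets of the triangle factors of $K_n$ (spanning subgraphs each of whose connected components is a triangle $K_3$). In the $(1:1)$ version Maker and Breaker alternately claim one previously unclaimed edge each; Maker wins as soon as his edges contain a triangle factor of $K_n$. *)

theory Defs
  imports Complex_Main
begin

section \<open>Triangle factors of the complete graph\<close>

text \<open>An undirected edge is a two-element set of vertices.\<close>

definition complete_edges :: "'v set \<Rightarrow> 'v set set" where
  "complete_edges V = {e. e \<subseteq> V \<and> card e = 2}"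

definition graph_components :: "'v set \<Rightarrow> 'v set set \<Rightarrow> 'v set set" where
  "graph_components V F =
     V // {(u, v). u \<in> V \<and> v \<in> V \<and> (u, v) \<in> {(x, y). {x, y} \<in> F}\<^sup>*}"

text \<open>A spanning subgraph with vertex set \<open>V\<close> is identified with its edge set \<open>F\<close>.\<close>

definition triangle_factors :: "'v set \<Rightarrow> 'v set set set" where
  "triangle_factors V =
     {F. F \<subseteq> complete_edges V \<and>
         (\<forall>C \<in> graph_components V F. card C = 3 \<and> {e \<in> F. e \<subseteq> C} = complete_edges C)}"

section \<open>(1:1) Maker-Breaker games\<close>

datatype player = Maker | Breaker

fun opponent :: "player \<Rightarrow> player" where
  "opponent Maker = Breaker"
| "opponent Breaker = Maker"

text \<open>A history is the list of all claimed board elements in chronological order; the players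
  alternate, and \<open>first\<close> makes the move with index \<open>0\<close>.\<close>

definition mover :: "player \<Rightarrow> nat \<Rightarrow> player" where
  "mover first i = (if even i then first else opponent first)"

definition legal_history :: "'a set \<Rightarrow> 'a list \<Rightarrow> bool" where
  "legal_history board h \<longleftrightarrow> distinct h \<and> set h \<subseteq> board"

definition maker_claimed :: "player \<Rightarrow> 'a list \<Rightarrow> 'a set" where
  "maker_claimed first h = {h ! i | i. i < length h \<and> mover first i = Maker}"

text \<open>Only Maker's own moves are counted.\<close>

definition maker_moves :: "player \<Rightarrow> 'a list \<Rightarrow> nat" where
  "maker_moves first h = card {i. i < length h \<and> mover first i = Maker}"

text \<open>Histories are not cut off when Maker wins. As his claimed set only grows, Maker has won in
  some history with at most \<open>k\<close> Maker moves iff he wins within his first \<open>k\<close> moves.\<close>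

definition maker_has_won :: "'a set set \<Rightarrow> player \<Rightarrow> 'a list \<Rightarrow> bool" where
  "maker_has_won winning first h \<longleftrightarrow> (\<exists>W \<in> winning. W \<subseteq> maker_claimed first h)"

definition breaker_strategy :: "'a set \<Rightarrow> player \<Rightarrow> ('a list \<Rightarrow> 'a) \<Rightarrow> bool" where
  "breaker_strategy board first \<sigma> \<longleftrightarrow>
     (\<forall>h. legal_history board h \<and> set h \<noteq> board \<and> mover first (length h) = Breaker
        \<longrightarrow> \<sigma> h \<in> board - set h)"

definition breaker_follows :: "player \<Rightarrow> ('a list \<Rightarrow> 'a) \<Rightarrow> 'a list \<Rightarrow> bool" where
  "breaker_follows first \<sigma> h \<longleftrightarrow>
     (\<forall>i < length h. mover first i = Breaker \<longrightarrow> h ! i = \<sigma> (take i h))"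

end

theory Submission
  imports Defs "HOL-Library.Disjoint_Sets"
begin

text \<open>Whenever Maker's last edge forms a path of length two with another of his edges, Breaker
  claims the third edge of that triangle if it is free. A Maker triangle that no further Maker edge
  meets cannot arise: when its second edge was played, its third edge was the only one of this kind.
  So every triangle of Maker's factor meets a Maker edge that leaves it. Such an edge
  meets at most two triangles, so besides the \<open>n\<close> edges of the factor Maker has spent at least
  \<open>(n / 3) / 2\<close> further edges.\<close>

lemma card_complete_edges:
  assumes "finite V"
  shows "card (complete_edges V) = card V choose 2"
  using n_subsets[OF assms, of 2] by (simp add: complete_edges_def)

lemma finite_complete_edges:
  assumes "finite V"
  shows "finite (complete_edges V)"
  using assms by (simp add: complete_edges_def)

lemma complete_edges_triple:
  assumes "distinct [a, b, c]"
  shows "complete_edges {a, b, c} = {{a, b}, {a, c}, {b, c}}"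
  using assms by (auto simp: complete_edges_def card_2_iff)

text \<open>Two edges of a triangle share exactly one vertex, which cancels. So the closing edge of
  a path of length two is computed from its two edges alone, without naming vertices.\<close>

lemma triangle_edges_sym_diff:
  assumes "card C = 3" "e \<in> complete_edges C" "f \<in> complete_edges C" "g \<in> complete_edges C"
    and "distinct [e, f, g]"
  shows "sym_diff e f = g"
proof -
  obtain a b c where C: "C = {a, b, c}" "distinct [a, b, c]"
    using assms(1) by (auto simp: card_3_iff)
  show ?thesis
    using assms(2-5) C(2) unfolding C(1) complete_edges_triple[OF C(2)] by auto
qed

lemma equiv_connected:
  "equiv V {(u, v). u \<in> V \<and> v \<in> V \<and> (u, v) \<in> {(x, y). {x, y} \<in> F}\<^sup>*}" (is "equiv V ?R")
proof (rule equivI)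
  show "?R \<subseteq> V \<times> V" "refl_on V ?R" by (auto simp: refl_on_def)
  have "sym {(x, y). {x, y} \<in> F}" by (auto simp: sym_def insert_commute)
  then have "sym ({(x, y). {x, y} \<in> F}\<^sup>*)" by (rule sym_rtrancl)
  then show "sym ?R" by (auto intro!: symI dest: symD)
  show "trans ?R" by (auto simp: trans_def)
qed

lemma partition_on_graph_components: "partition_on V (graph_components V F)"
  unfolding graph_components_def by (rule partition_on_quotient[OF equiv_connected])

text \<open>No edge is claimed twice, so indices and claimed edges correspond one to one. This turns
  a lower bound on the size of Maker's graph into one on his number of moves.\<close>

lemma card_maker_claimed:
  assumes "distinct h"
  shows "card (maker_claimed first h) = maker_moves first h"
proof -
  have "maker_claimed first h = (!) h ` {i. i < length h \<and> mover first i = Maker}"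
    by (auto simp: maker_claimed_def)
  moreover have "inj_on ((!) h) {i. i < length h \<and> mover first i = Maker}"
    using assms by (auto simp: inj_on_def nth_eq_iff_index_eq)
  ultimately show ?thesis
    by (simp add: maker_moves_def card_image)
qed

lemma mover_Suc: "mover first (Suc i) = opponent (mover first i)"
  by (cases first) (auto simp: mover_def)

text \<open>When Breaker is to move in a nonempty history, \<open>last h\<close> is Maker's latest
  edge. On a complete graph the symmetric difference of two edges is again an edge exactly when they
  share one vertex, so membership in \<open>board\<close> discards equal and disjoint pairs. For the
  empty history \<open>last h\<close> is unspecified, but then Maker owns no \<open>f\<close> and
  nothing qualifies.\<close>

definition closes_last :: "'v set set \<Rightarrow> player \<Rightarrow> 'v set list \<Rightarrow> 'v set \<Rightarrow> bool" where
  "closes_last board first h e \<longleftrightarrow>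
     e \<in> board - set h \<and> (\<exists>f \<in> maker_claimed first h. e = sym_diff f (last h))"

text \<open>If several edges would close a triangle, the choice among them is arbitrary. The reply
  is therefore predictable only when there is exactly one candidate.\<close>

definition closing_strategy :: "'v set set \<Rightarrow> player \<Rightarrow> 'v set list \<Rightarrow> 'v set" where
  "closing_strategy board first h =
     (if \<exists>e. closes_last board first h e then SOME e. closes_last board first h e
      else SOME e. e \<in> board - set h)"

lemma breaker_strategy_closing: "breaker_strategy board first (closing_strategy board first)"
  unfolding breaker_strategy_def
proof (intro allI impI)
  fix h assume h: "legal_history board h \<and> set h \<noteq> board \<and> mover first (length h) = Breaker"
  then have "\<exists>e. e \<in> board - set h" by (auto simp: legal_history_def)
  from someI_ex[OF this] have "(SOME e. e \<in> board - set h) \<in> board - set h" .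
  moreover have "(SOME e. closes_last board first h e) \<in> board - set h"
    if "\<exists>e. closes_last board first h e"
    using someI_ex[OF that] unfolding closes_last_def by (rule conjunct1)
  ultimately show "closing_strategy board first h \<in> board - set h"
    unfolding closing_strategy_def by (cases "\<exists>e. closes_last board first h e") (simp_all only: if_True if_False simp_thms)
qed

text \<open>The indices \<open>i\<close>, \<open>j\<close>, \<open>k\<close> are the times at which
  Maker claims the edges of \<open>C\<close>. Right after time \<open>j\<close> the edge
  \<open>h ! k\<close> is still free and is the only candidate of the strategy, so Breaker claims it
  at time \<open>Suc j\<close> and Maker cannot own it.\<close>

lemma closing_strategy_no_isolated_triangle_ordered:
  fixes h :: "'v set list"
  assumes h: "legal_history (complete_edges V) h"
      "breaker_follows first (closing_strategy (complete_edges V) first) h"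
    and C: "card C = 3"
    and isolated: "\<And>e. e \<in> maker_claimed first h \<Longrightarrow> e \<inter> C \<noteq> {} \<Longrightarrow> e \<subseteq> C"
    and ijk: "i < j" "j < k" "k < length h"
    and maker: "mover first i = Maker" "mover first j = Maker" "mover first k = Maker"
    and edges: "complete_edges C = {h ! i, h ! j, h ! k}"
  shows False
proof -
  \<comment> \<open>This prefix holds the indices up to and including \<open>j\<close>: it is the
    position Breaker faces just after Maker's second edge of \<open>C\<close>.\<close>
  let ?h = "take (Suc j) h"
  have dist: "distinct h" and board: "set h \<subseteq> complete_edges V"
    using h(1) by (auto simp: legal_history_def)
  have breaker: "mover first (Suc j) = Breaker"
    using maker(2) by (simp add: mover_Suc)
  have Suc_j: "Suc j < k"
    using ijk(2) maker(3) breaker by (metis Suc_lessI player.distinct(1))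
  have last: "last ?h = h ! j"
    using ijk by (simp add: take_Suc_conv_app_nth)
  have fresh: "h ! k \<notin> set ?h"
    using dist ijk by (auto simp: in_set_conv_nth nth_eq_iff_index_eq)
  have neq: "distinct [h ! i, h ! j, h ! k]"
    using dist ijk by (auto simp: nth_eq_iff_index_eq)
  have sd: "sym_diff (h ! i) (h ! j) = h ! k"
    using edges by (intro triangle_edges_sym_diff[OF C _ _ _ neq]) auto
  \<comment> \<open>Uniqueness of the candidate is what pins down the value of \<open>SOME\<close>
    in the strategy.\<close>
  have "closes_last (complete_edges V) first ?h e \<longleftrightarrow> e = h ! k" for e
  proof
    assume "e = h ! k"
    moreover have "h ! i \<in> maker_claimed first ?h"
      using ijk maker(1) by (auto simp: maker_claimed_def intro!: exI[of _ i])
    moreover have "h ! k \<in> complete_edges V"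
      using board ijk by auto
    ultimately show "closes_last (complete_edges V) first ?h e"
      using fresh sd unfolding closes_last_def last by blast
  next
    assume "closes_last (complete_edges V) first ?h e"
    then obtain f where f: "f \<in> maker_claimed first ?h" "e = sym_diff f (h ! j)"
      and card_e: "card e = 2"
      unfolding closes_last_def last by (auto simp: complete_edges_def)
    have f_maker: "f \<in> maker_claimed first h" and f_set: "f \<in> set ?h"
      using f(1) by (auto simp: maker_claimed_def in_set_conv_nth)
    have "f \<in> complete_edges V"
      using f_set board by (meson in_set_takeD subsetD)
    then have card_f: "card f = 2" by (simp add: complete_edges_def)
    have hj: "h ! j \<subseteq> C" "card (h ! j) = 2"
      using edges by (auto simp: complete_edges_def)
    \<comment> \<open>Otherwise \<open>e\<close> would have four vertices.\<close>
    have "f \<inter> h ! j \<noteq> {}"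
    proof
      assume disj: "f \<inter> h ! j = {}"
      then have "e = f \<union> h ! j" using f(2) by auto
      moreover have "card (f \<union> h ! j) = 4"
        using disj card_f hj(2) by (subst card_Un_disjoint) (auto intro: card_ge_0_finite)
      ultimately show False using card_e by simp
    qed
    \<comment> \<open>Isolation is assumed for the final history, but Maker's edges in the prefix
      are among his edges there. Of the edges inside \<open>C\<close>, only \<open>h ! i\<close> is
      then left for \<open>f\<close>.\<close>
    then have "f \<subseteq> C" using isolated[OF f_maker] hj(1) by blast
    then have "f \<in> {h ! i, h ! j, h ! k}"
      using card_f edges by (auto simp: complete_edges_def)
    moreover have "f \<noteq> h ! j" using f(2) card_e by auto
    moreover have "f \<noteq> h ! k" using f_set fresh by auto
    ultimately have "f = h ! i" by auto
    then show "e = h ! k" using f(2) sd by simp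
  qed
  then have "closes_last (complete_edges V) first ?h = (\<lambda>e. e = h ! k)" by blast
  then have "closing_strategy (complete_edges V) first ?h = h ! k"
    by (simp add: closing_strategy_def)
  moreover have "h ! Suc j = closing_strategy (complete_edges V) first ?h"
    using h(2) breaker Suc_j ijk(3) by (auto simp: breaker_follows_def)
  \<comment> \<open>The same edge would stand at the two different positions \<open>Suc j\<close>
    and \<open>k\<close>.\<close>
  ultimately show False
    using dist Suc_j ijk(3) by (simp add: nth_eq_iff_index_eq)
qed

lemma closing_strategy_no_isolated_triangle:
  fixes h :: "'v set list"
  assumes h: "legal_history (complete_edges V) h"
      "breaker_follows first (closing_strategy (complete_edges V) first) h"
    and C: "card C = 3" "complete_edges C \<subseteq> maker_claimed first h"
  obtains e where "e \<in> maker_claimed first h" "e \<inter> C \<noteq> {}" "\<not> e \<subseteq> C"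
proof (rule ccontr)
  assume "\<not> thesis"
  with that have isolated: "\<And>e. e \<in> maker_claimed first h \<Longrightarrow> e \<inter> C \<noteq> {} \<Longrightarrow> e \<subseteq> C"
    by blast
  have "finite C" using C(1) by (simp add: card_ge_0_finite)
  then have "card (complete_edges C) = 3"
    using C(1) by (simp add: card_complete_edges choose_two)
  then obtain x y z where xyz: "complete_edges C = {x, y, z}" "distinct [x, y, z]"
    by (auto simp: card_3_iff)
  from C(2) xyz obtain i j k where ijk: "i < length h" "j < length h" "k < length h"
    "mover first i = Maker" "mover first j = Maker" "mover first k = Maker"
    and edges: "x = h ! i" "y = h ! j" "z = h ! k"
    by (auto simp: maker_claimed_def)
  \<comment> \<open>Nothing is known about the order in which Maker took the three edges. The
    statement about the set of indices is symmetric, so any increasing arrangement \<open>a\<close>,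
    \<open>b\<close>, \<open>c\<close> of them will do, and the six orders are then handled
    alike.\<close>
  have ordered: False if abc: "a < b" "b < c" "{a, b, c} = {i, j, k}" for a b c
  proof (rule closing_strategy_no_isolated_triangle_ordered[OF h C(1) isolated abc(1,2)])
    have all: "t < length h" "mover first t = Maker" if "t \<in> {a, b, c}" for t
      using that ijk unfolding abc(3) by auto
    from all show "c < length h" "mover first a = Maker" "mover first b = Maker"
      "mover first c = Maker" by blast+
    have "complete_edges C = (!) h ` {a, b, c}"
      unfolding abc(3) using xyz(1) edges by simp
    then show "complete_edges C = {h ! a, h ! b, h ! c}" by simp
  qed
  have "distinct [i, j, k]" using xyz(2) edges by auto
  then consider "i < j" "j < k" | "i < k" "k < j" | "j < i" "i < k" | "j < k" "k < i"
    | "k < i" "i < j" | "k < j" "j < i"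
    by (auto simp: neq_iff)
  then show False
    by cases (erule (1) ordered, blast)+
qed

lemma edges_ge_leaving_triangle_factor:
  assumes V: "finite V" and M: "M \<subseteq> complete_edges V"
    and F: "F \<in> triangle_factors V" "F \<subseteq> M"
    and leaving: "\<And>C. C \<in> graph_components V F \<Longrightarrow> \<exists>e \<in> M. e \<inter> C \<noteq> {} \<and> \<not> e \<subseteq> C"
  shows "7 * card V \<le> 6 * card M"
proof -
  let ?P = "graph_components V F"
  \<comment> \<open>These are the edges of \<open>M\<close> beyond the factor: they join different
    triangles.\<close>
  define X where "X = {e \<in> M. \<forall>C \<in> ?P. \<not> e \<subseteq> C}"
  have part: "partition_on V ?P" by (rule partition_on_graph_components)
  have finP: "finite ?P" using finite_elements[OF V part] .
  have C3: "card C = 3" "complete_edges C \<subseteq> M" "finite C" if "C \<in> ?P" for C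
    using F that by (auto simp: triangle_factors_def intro: card_ge_0_finite)
  have finM: "finite M" using finite_subset[OF M finite_complete_edges[OF V]] .
  have uniq: "C = D" if "C \<in> ?P" "D \<in> ?P" "x \<in> C" "x \<in> D" for C D x
    using partition_onD2[OF part] that by (auto simp: disjoint_def)
  have inner: "card (\<Union>C\<in>?P. complete_edges C) = 3 * card ?P"
  proof -
    have "complete_edges C \<inter> complete_edges D = {}" if "C \<in> ?P" "D \<in> ?P" "C \<noteq> D" for C D
    proof -
      have "C \<inter> D = {}" using uniq that by blast
      moreover have "e \<subseteq> C \<inter> D \<and> card e = 2"
        if "e \<in> complete_edges C \<inter> complete_edges D" for e
        using that by (auto simp: complete_edges_def)
      ultimately show ?thesis by fastforce
    qed
    then have "card (\<Union>C\<in>?P. complete_edges C) = (\<Sum>C\<in>?P. card (complete_edges C))"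
      using finP C3(3) by (intro card_UN_disjoint) (auto simp: finite_complete_edges)
    also have "\<dots> = (\<Sum>C\<in>?P. 3)"
      by (intro sum.cong) (simp_all add: C3 card_complete_edges choose_two)
    finally show ?thesis by simp
  qed
  have cardV: "card V = 3 * card ?P"
  proof -
    have "card V = sum card ?P"
      using card_Union_disjoint[of ?P] partition_onD1[OF part] partition_onD2[OF part] C3(3)
      by (simp add: disjoint_def pairwise_def disjnt_def)
    then show ?thesis using C3(1) by simp
  qed
  \<comment> \<open>Every triangle contains a vertex covered by \<open>X\<close>. Picking one such
    vertex \<open>r C\<close> in each is injective because the triangles are disjoint.\<close>
  have "card ?P \<le> card (\<Union>X)"
  proof -
    have "\<exists>x. x \<in> C \<and> x \<in> \<Union>X" if "C \<in> ?P" for C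
    proof -
      obtain e x where e: "e \<in> M" "x \<in> e" "x \<in> C" "\<not> e \<subseteq> C"
        using leaving[OF \<open>C \<in> ?P\<close>] by blast
      \<comment> \<open>A triangle containing \<open>e\<close> would contain \<open>x\<close>, hence
        be \<open>C\<close> itself, but \<open>e\<close> leaves \<open>C\<close>.\<close>
      moreover have "e \<in> X"
        unfolding X_def using e uniq[OF \<open>C \<in> ?P\<close>] by blast
      ultimately show ?thesis by blast
    qed
    then obtain r where r: "\<And>C. C \<in> ?P \<Longrightarrow> r C \<in> C \<and> r C \<in> \<Union>X" by metis
    have "inj_on r ?P"
      using r uniq by (metis inj_onI)
    moreover have "finite (\<Union>X)"
      by (rule finite_subset[OF _ V]) (use M in \<open>auto simp: X_def complete_edges_def\<close>)
    ultimately show ?thesis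
      using r by (intro card_inj_on_le[of r]) auto
  qed
  also have "\<dots> \<le> sum card X"
    by (rule card_Union_le_sum_card)
  also have "\<dots> = 2 * card X"
    using M by (subst sum.cong[of X X card "\<lambda>_. 2"]) (auto simp: X_def complete_edges_def)
  finally have "card ?P \<le> 2 * card X" .
  moreover have "card (\<Union>C\<in>?P. complete_edges C) + card X \<le> card M"
  proof -
    have "(\<Union>C\<in>?P. complete_edges C) \<inter> X = {}"
      by (auto simp: X_def complete_edges_def)
    moreover have "(\<Union>C\<in>?P. complete_edges C) \<union> X \<subseteq> M"
      using C3(2) by (auto simp: X_def)
    ultimately show ?thesis
      using finM by (metis card_Un_disjoint card_mono finite_Un finite_subset)
  qed
  \<comment> \<open>With \<open>p = card ?P\<close>, the bounds read \<open>card V = 3 * p\<close>,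
    \<open>p \<le> 2 * card X\<close> and \<open>3 * p + card X \<le> card M\<close>. Hence
    \<open>6 * card M \<ge> 18 * p + 3 * p = 7 * card V\<close>.\<close>
  ultimately show ?thesis
    using inner cardV by linarith
qed

theorem theorem4p3:
  fixes n :: nat and first :: player
  assumes "n > 0" and "3 dvd n"
  shows "\<exists>\<sigma>. breaker_strategy (complete_edges {1..n}) first \<sigma> \<and>
           (\<forall>h. legal_history (complete_edges {1..n}) h \<and> breaker_follows first \<sigma> h \<and>
                real (maker_moves first h) < 7 * real n / 6
              \<longrightarrow> \<not> maker_has_won (triangle_factors {1..n}) first h)"
proof (intro exI conjI allI impI)
  let ?B = "complete_edges {1..n}"
  show "breaker_strategy ?B first (closing_strategy ?B first)"
    by (rule breaker_strategy_closing)
  fix h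
  assume h: "legal_history ?B h \<and> breaker_follows first (closing_strategy ?B first) h \<and>
    real (maker_moves first h) < 7 * real n / 6"
  let ?M = "maker_claimed first h"
  show "\<not> maker_has_won (triangle_factors {1..n}) first h"
  proof
    assume "maker_has_won (triangle_factors {1..n}) first h"
    then obtain F where F: "F \<in> triangle_factors {1..n}" "F \<subseteq> ?M"
      by (auto simp: maker_has_won_def)
    have "7 * card {1..n} \<le> 6 * card ?M"
    proof (rule edges_ge_leaving_triangle_factor[OF _ _ F])
      show "?M \<subseteq> ?B"
        using h by (auto simp: maker_claimed_def legal_history_def)
      fix C assume "C \<in> graph_components {1..n} F"
      then have "card C = 3" "complete_edges C \<subseteq> ?M"
        using F by (auto simp: triangle_factors_def)
      with h obtain e where "e \<in> ?M" "e \<inter> C \<noteq> {}" "\<not> e \<subseteq> C"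
        by (elim conjE) (rule closing_strategy_no_isolated_triangle)
      then show "\<exists>e\<in>?M. e \<inter> C \<noteq> {} \<and> \<not> e \<subseteq> C" by blast
    qed simp
    moreover have "card ?M = maker_moves first h"
      using h by (simp add: card_maker_claimed legal_history_def)
    ultimately show False
      using h by (simp add: field_simps)
  qed
qed

end
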